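(* Let $E$ be a principal ideal domain, $k\ge1$, and let $f_1,\ldots,f_k\in E[x]$ and $\mathcal{R}\subseteq E[x]$ define a simultaneous digit system $(V,\phi,N)$. Then $(V,\phi,N)$ has the Finite Expansion Property if and only if (i) $(f_i,f_j)=(1)$ as ideals of $E[x]$ for all $i\ne j$, and (ii) the digit system $(E[x]/(f_1f_2\cdots f_k),X,\mathcal{R})$ (digits taken as residue classes) has the Finite Expansion Property.
   Context: Simultaneous digit system: $f_1,\ldots,f_k\in E[x]$ are pairwise coprime (pairwise trivial gcd), $f_1(0),\ldots,f_k(0)$ are pairwise coprime in $E$, and $\mathcal{R}\subseteq E[x]$ is a set of polynomials whose constant coefficients form a complete system of representatives of $E$ modulo $f_1(0)\cdots f_k(0)$. Then $V=E[x]/(f_1)\times\cdots\times E[x]/(f_k)$, $\phi(a_1,\ldots,a_k)=(Xa_1,\ldots,Xa_k)$ with $X$ the residue class of $x$, and $N=\{(c,\ldots,c)\mid c\in\mathcal{R}\}$ (the $i$-th component read modulo $f_i$). A triple $(V,\phi,D)$ has the Finite Expansion Property if every $v\in V$ equals $\sum_{i=0}^\ell\phi^i(d_i)$ with $d_i\in D$. $(f_i,f_j)$ is the ideal generated by $f_i,f_j$. *)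

theory Defs
  imports "HOL-Algebra.Algebra"
begin

text \<open>
  Only the additive structure of \<^term>\<open>V\<close> is used. The upper index \<^term>\<open>l\<close> may depend on
  \<^term>\<open>v\<close>; an expansion has at least the digit \<^term>\<open>d 0\<close>, so \<^term>\<open>\<zero>\<^bsub>V\<^esub>\<close> also
  needs an expansion.
\<close>

definition finite_expansion_property ::
    "('v, 'm) ring_scheme \<Rightarrow> ('v \<Rightarrow> 'v) \<Rightarrow> 'v set \<Rightarrow> bool"
  where "finite_expansion_property V \<phi> D \<longleftrightarrow>
    (\<forall>v\<in>carrier V. \<exists>(l::nat) d. (\<forall>i\<le>l. d i \<in> D) \<and>
       v = (\<Oplus>\<^bsub>V\<^esub>i\<in>{..l}. (\<phi> ^^ i) (d i)))"

definition complete_representatives ::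
    "('a, 'm) ring_scheme \<Rightarrow> 'a \<Rightarrow> 'a set \<Rightarrow> bool"
  where "complete_representatives E m C \<longleftrightarrow>
    C \<subseteq> carrier E \<and>
    bij_betw (\<lambda>c. PIdl\<^bsub>E\<^esub> m +>\<^bsub>E\<^esub> c) C (carrier (E Quot (PIdl\<^bsub>E\<^esub> m)))"

text \<open>The ring \<open>E[x]/(f)\<close>, and the class of \<^term>\<open>g\<close> in it.\<close>

definition poly_quotient :: "('a, 'm) ring_scheme \<Rightarrow> 'a list \<Rightarrow> 'a list set ring"
  where "poly_quotient E f = poly_ring E Quot (PIdl\<^bsub>poly_ring E\<^esub> f)"

definition residue_class :: "('a, 'm) ring_scheme \<Rightarrow> 'a list \<Rightarrow> 'a list \<Rightarrow> 'a list set"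
  where "residue_class E f g = PIdl\<^bsub>poly_ring E\<^esub> f +>\<^bsub>poly_ring E\<^esub> g"

definition mult_X :: "('a, 'm) ring_scheme \<Rightarrow> 'a list \<Rightarrow> 'a list set \<Rightarrow> 'a list set"
  where "mult_X E f a = residue_class E f X\<^bsub>E\<^esub> \<otimes>\<^bsub>poly_quotient E f\<^esub> a"

text \<open>
  Trivial gcd means that \<open>1\<close> is a greatest common divisor. The constant coefficient
  of \<^term>\<open>p\<close> is its value at zero, \<^term>\<open>ring.const_term E p\<close>. What is required of
  \<^term>\<open>R\<close> concerns the set of constant coefficients of its members.
\<close>

definition simultaneous_digit_system ::
    "('a, 'm) ring_scheme \<Rightarrow> nat \<Rightarrow> (nat \<Rightarrow> 'a list) \<Rightarrow> 'a list set \<Rightarrow> bool"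
  where "simultaneous_digit_system E k f R \<longleftrightarrow>
    (\<forall>i\<in>{1..k}. f i \<in> carrier (poly_ring E)) \<and>
    (\<forall>i\<in>{1..k}. \<forall>j\<in>{1..k}. i \<noteq> j \<longrightarrow>
       \<one>\<^bsub>poly_ring E\<^esub> gcdof\<^bsub>poly_ring E\<^esub> (f i) (f j)) \<and>
    (\<forall>i\<in>{1..k}. \<forall>j\<in>{1..k}. i \<noteq> j \<longrightarrow>
       \<one>\<^bsub>E\<^esub> gcdof\<^bsub>E\<^esub> (ring.const_term E (f i)) (ring.const_term E (f j))) \<and>
    R \<subseteq> carrier (poly_ring E) \<and>
    complete_representatives E (\<Otimes>\<^bsub>E\<^esub>i\<in>{1..k}. ring.const_term E (f i))
      (ring.const_term E ` R)"

text \<open>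
  The triple \<open>(V, \<phi>, N)\<close> of a simultaneous digit system. A tuple \<open>(a\<^sub>1, ..., a\<^sub>k)\<close> is the
  list of its entries.
\<close>

definition simultaneous_space ::
    "('a, 'm) ring_scheme \<Rightarrow> nat \<Rightarrow> (nat \<Rightarrow> 'a list) \<Rightarrow> 'a list set list ring"
  where "simultaneous_space E k f =
    RDirProd_list (map (\<lambda>i. poly_quotient E (f i)) [1..<Suc k])"

definition simultaneous_map ::
    "('a, 'm) ring_scheme \<Rightarrow> nat \<Rightarrow> (nat \<Rightarrow> 'a list) \<Rightarrow> 'a list set list \<Rightarrow> 'a list set list"
  where "simultaneous_map E k f as = map2 (\<lambda>i a. mult_X E (f i) a) [1..<Suc k] as"

definition simultaneous_digits ::
    "('a, 'm) ring_scheme \<Rightarrow> nat \<Rightarrow> (nat \<Rightarrow> 'a list) \<Rightarrow> 'a list set \<Rightarrow> 'a list set list set"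
  where "simultaneous_digits E k f R =
    (\<lambda>c. map (\<lambda>i. residue_class E (f i) c) [1..<Suc k]) ` R"

end

theory Submission
  imports Defs
begin

text \<open>
  Both digit systems are images of \<open>E[x]\<close> under ring homomorphisms that turn \<open>\<phi>\<close> into
  multiplication by \<open>x\<close>, so each has the Finite Expansion Property iff the same set \<open>S\<close> of
  polynomials \<open>\<Sum> x\<^sup>i c\<^sub>i\<close> with \<open>c\<^sub>i \<in> \<R>\<close> maps onto it. If \<open>S\<close> maps onto \<open>V\<close>, then so does
  \<open>E[x]\<close>, and lifting the unit vectors shows that the ideals \<open>(f\<^sub>i)\<close> are pairwise comaximal.
  If they are, then \<open>E[x]\<close> maps onto \<open>V\<close> by the Chinese Remainder Theorem, and the kernel is
  \<open>\<Inter>(f\<^sub>i) = (f\<^sub>1\<cdots>f\<^sub>k)\<close>, so \<open>S\<close> covers \<open>V\<close> iff it covers \<open>E[x]/(f\<^sub>1\<cdots>f\<^sub>k)\<close>.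
\<close>

text \<open>Additivity of \<open>h\<close> and the intertwining relation turn a sum of
  \<open>x [^] i \<otimes> c i\<close> into the expansion with digits \<open>h (c i)\<close>. The
  relation is required on the image of \<open>h\<close> only, because \<open>h\<close> need not be
  onto.\<close>

lemma (in ring_hom_ring) finite_expansion_property_hom_iff:
  assumes "x \<in> carrier R" and "C \<subseteq> carrier R"
    and \<phi>: "\<And>p. p \<in> carrier R \<Longrightarrow> \<phi> (h p) = h (x \<otimes> p)"
  shows "finite_expansion_property S \<phi> (h ` C) \<longleftrightarrow>
    carrier S \<subseteq> h ` {\<Oplus>i\<in>{..l::nat}. x [^] i \<otimes> c i | l c. \<forall>i\<le>l. c i \<in> C}"
proof -
  have pow: "(\<phi> ^^ i) (h p) = h (x [^] i \<otimes> p)" if "p \<in> carrier R" for i :: nat and p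
    using that
  proof (induction i)
    case 0
    then show ?case by simp
  next
    case (Suc i)
    \<comment> \<open>Multiplication need not commute here, so the factor that \<open>\<phi>\<close>
      adds on the left is absorbed by \<open>nat_pow_Suc2\<close>.\<close>
    have "x \<otimes> (x [^] i \<otimes> p) = x [^] Suc i \<otimes> p"
      using Suc.prems assms(1) R.nat_pow_Suc2[of x i] by (simp add: R.m_assoc[symmetric])
    then show ?case
      using Suc assms(1) \<phi>[of "x [^] i \<otimes> p"] by simp
  qed
  have sum: "(\<Oplus>\<^bsub>S\<^esub>i\<in>{..l}. (\<phi> ^^ i) (d i)) = h (\<Oplus>i\<in>{..l}. x [^] i \<otimes> c i)"
    if "\<forall>i\<le>l. c i \<in> C" "\<forall>i\<le>l. d i = h (c i)" for l :: nat and c d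
  proof -
    have "c i \<in> carrier R" if "i \<le> l" for i
      using that \<open>\<forall>i\<le>l. c i \<in> C\<close> assms(2) by blast
    then show ?thesis
      using that assms(1)
      by (subst hom_finsum) (auto intro!: S.finsum_cong' simp: pow Pi_def)
  qed
  show ?thesis
  proof
    assume fep: "finite_expansion_property S \<phi> (h ` C)"
    show "carrier S \<subseteq> h ` {\<Oplus>i\<in>{..l::nat}. x [^] i \<otimes> c i | l c. \<forall>i\<le>l. c i \<in> C}"
    proof
      fix v assume "v \<in> carrier S"
      then obtain l :: nat and d where d: "\<forall>i\<le>l. d i \<in> h ` C"
        and v: "v = (\<Oplus>\<^bsub>S\<^esub>i\<in>{..l}. (\<phi> ^^ i) (d i))"
        using fep unfolding finite_expansion_property_def by blast
      \<comment> \<open>The guard \<open>i \<le> l\<close> makes the choice of preimages total;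
        beyond \<open>l\<close> nothing is asked of \<open>c i\<close>.\<close>
      have "\<forall>i. \<exists>c. i \<le> l \<longrightarrow> c \<in> C \<and> d i = h c"
        using d by blast
      then obtain c where "\<forall>i\<le>l. c i \<in> C" "\<forall>i\<le>l. d i = h (c i)"
        by metis
      with sum[OF this] v
      show "v \<in> h ` {\<Oplus>i\<in>{..l::nat}. x [^] i \<otimes> c i | l c. \<forall>i\<le>l. c i \<in> C}"
        by blast
    qed
  next
    assume sub: "carrier S \<subseteq> h ` {\<Oplus>i\<in>{..l::nat}. x [^] i \<otimes> c i | l c. \<forall>i\<le>l. c i \<in> C}"
    show "finite_expansion_property S \<phi> (h ` C)"
      unfolding finite_expansion_property_def
    proof
      fix v assume "v \<in> carrier S"
      then obtain l :: nat and c where c: "\<forall>i\<le>l. c i \<in> C"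
        and v: "v = h (\<Oplus>i\<in>{..l}. x [^] i \<otimes> c i)"
        using sub by blast
      show "\<exists>(l::nat) d. (\<forall>i\<le>l. d i \<in> h ` C) \<and> v = (\<Oplus>\<^bsub>S\<^esub>i\<in>{..l}. (\<phi> ^^ i) (d i))"
        using c v sum[OF c, of "\<lambda>i. h (c i)"]
        by (intro exI[of _ l] exI[of _ "\<lambda>i. h (c i)"]) auto
    qed
  qed
qed

text \<open>Converse of the Chinese Remainder Theorem: a preimage \<open>p\<close> of the tuple with
  \<open>\<one>\<close> at position \<open>i\<close> and \<open>\<zero>\<close> elsewhere has
  \<open>\<one> \<ominus> p\<close> in \<open>I i\<close> and \<open>p\<close> in
  \<open>I j\<close>, and these add up to \<open>\<one>\<close>.\<close>

lemma (in ring) canonical_proj_ext_surj_imp_comaximal: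
  assumes ideals: "\<And>i. i \<le> n \<Longrightarrow> ideal (I i) R"
    and surj: "carrier (RDirProd_list (map (\<lambda>i. R Quot (I i)) [0..<Suc n]))
      \<subseteq> canonical_proj_ext I n ` carrier R"
    and ij: "i \<le> n" "j \<le> n" "i \<noteq> j"
  shows "I i <+>\<^bsub>R\<^esub> I j = carrier R"
proof -
  define e where "e m = (if m = i then \<one> else \<zero>)" for m
  have e: "e m \<in> carrier R" for m
    by (simp add: e_def)
  have "map (\<lambda>m. I m +> e m) [0..<Suc n]
      \<in> carrier (RDirProd_list (map (\<lambda>i. R Quot (I i)) [0..<Suc n]))"
    by (rule RDirProd_list_carrier_memI)
      (auto simp: nth_map_upt FactRing_def A_RCOSETS_def' e simp del: upt_Suc)
  then obtain p where p: "p \<in> carrier R"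
    and eq: "map (\<lambda>m. I m +> p) [0..<Suc n] = map (\<lambda>m. I m +> e m) [0..<Suc n]"
    using surj unfolding canonical_proj_ext_def by (smt (verit) imageE subsetD)
  have diff: "e m \<ominus> p \<in> I m" if "m \<le> n" for m
    using that eq quotient_eq_iff_same_a_r_cos[OF ideals[OF that] e p]
    by (simp add: less_Suc_eq_le del: upt_Suc)
  interpret J: ideal "I i <+>\<^bsub>R\<^esub> I j" R
    by (intro add_ideals ideals ij)
  interpret Ij: ideal "I j" R
    by (intro ideals ij)
  have "\<one> \<ominus> p \<in> I i" "\<zero> \<ominus> p \<in> I j"
    using diff[of i] diff[of j] ij by (simp_all add: e_def)
  moreover from this(2) have "\<ominus> (\<zero> \<ominus> p) \<in> I j"
    by blast
  then have "p \<in> I j"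
    using p by (simp add: minus_eq)
  ultimately have "(\<one> \<ominus> p) \<oplus> p \<in> I i <+>\<^bsub>R\<^esub> I j"
    unfolding set_add_def' by blast
  then have "\<one> \<in> I i <+>\<^bsub>R\<^esub> I j"
    using p by (simp add: minus_eq a_assoc l_neg)
  then show ?thesis
    by (rule J.one_imp_carrier)
qed

text \<open>Induction on \<open>n\<close>: the intersection of the ideals so far stays comaximal
  with the next one, and the product of two comaximal ideals is their intersection.\<close>

lemma (in cring) cgenideal_finprod_eq_Inter:
  fixes n :: nat
  assumes "\<And>i. i \<le> n \<Longrightarrow> a i \<in> carrier R"
    and "\<And>i j. i \<le> n \<Longrightarrow> j \<le> n \<Longrightarrow> i \<noteq> j \<Longrightarrow> PIdl (a i) <+>\<^bsub>R\<^esub> PIdl (a j) = carrier R"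
  shows "PIdl (\<Otimes>i\<in>{..n}. a i) = (\<Inter>i\<le>n. PIdl (a i))"
  using assms
proof (induction n)
  case 0
  then show ?case by simp
next
  case (Suc n)
  let ?p = "\<Otimes>i\<in>{..n}. a i"
  have p: "?p \<in> carrier R" and b: "a (Suc n) \<in> carrier R"
    using Suc.prems(1) by (auto intro: finprod_closed)
  have IH: "PIdl ?p = (\<Inter>i\<le>n. PIdl (a i))"
    using Suc by simp
  have comax: "PIdl ?p <+>\<^bsub>R\<^esub> PIdl (a (Suc n)) = carrier R"
    unfolding IH
    using inter_plus_ideal_eq_carrier[of n "\<lambda>i. PIdl (a i)"] Suc.prems by (simp add: cgenideal_ideal)
  \<comment> \<open>An ideal product is the ideal generated by the elementwise product. Here that
    set is already a principal ideal, so generating again must add nothing.\<close>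
  have "Idl (PIdl (?p \<otimes> a (Suc n))) = PIdl (?p \<otimes> a (Suc n))"
    using p b by (intro subset_antisym genideal_minimal genideal_self)
      (auto intro: cgenideal_ideal ideal.Icarr[OF cgenideal_ideal])
  then have "PIdl (?p \<otimes> a (Suc n)) = (PIdl ?p) \<cdot> (PIdl (a (Suc n)))"
    using p b by (simp add: ideal_prod_eq_genideal cgenideal_ideal cgenideal_prod)
  also have "\<dots> = PIdl ?p \<inter> PIdl (a (Suc n))"
    using p b comax by (intro ideal_prod_eq_inter cgenideal_ideal)
  finally show ?case
    using Suc.prems(1) p b IH by (simp add: atMost_Suc finprod_insert m_comm Int_commute Pi_def)
qed

text \<open>Links condition (i), stated with generated ideals, to the sums of ideals in the Chinese
  Remainder Theorem: the sum is the smallest ideal containing both generators.\<close>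

lemma (in cring) genideal_pair_eq_one_iff:
  assumes "a \<in> carrier R" "b \<in> carrier R"
  shows "Idl {a, b} = Idl {\<one>} \<longleftrightarrow> PIdl a <+>\<^bsub>R\<^esub> PIdl b = carrier R"
proof -
  have ab: "{a, b} \<subseteq> carrier R"
    using assms by simp
  have union: "PIdl a \<union> PIdl b \<subseteq> carrier R"
    using assms by (meson Un_least cgenideal_ideal cgenideal_minimal oneideal)
  have "Idl {a, b} = Idl (PIdl a \<union> PIdl b)"
  proof
    show "Idl {a, b} \<subseteq> Idl (PIdl a \<union> PIdl b)"
      using assms by (intro subset_Idl_subset[OF union]) (simp add: cgenideal_self)
    show "Idl (PIdl a \<union> PIdl b) \<subseteq> Idl {a, b}"
      using genideal_self[OF ab]
      by (intro genideal_minimal genideal_ideal ab Un_least cgenideal_minimal) simp_all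
  qed
  also have "\<dots> = PIdl a <+>\<^bsub>R\<^esub> PIdl b"
    using assms by (intro union_genideal cgenideal_ideal)
  finally have "Idl {a, b} = PIdl a <+>\<^bsub>R\<^esub> PIdl b" .
  then show ?thesis
    by (simp add: genideal_one)
qed

theorem theorem4p4:
  fixes E :: "('a, 'm) ring_scheme"
    and k :: nat
    and f :: "nat \<Rightarrow> 'a list"
    and R :: "'a list set"
  assumes "principal_domain E"
    and "k \<ge> 1"
    and "simultaneous_digit_system E k f R"
  shows "finite_expansion_property (simultaneous_space E k f) (simultaneous_map E k f)
           (simultaneous_digits E k f R)
    \<longleftrightarrow>
      (\<forall>i\<in>{1..k}. \<forall>j\<in>{1..k}. i \<noteq> j \<longrightarrow>
         Idl\<^bsub>poly_ring E\<^esub> {f i, f j} = Idl\<^bsub>poly_ring E\<^esub> {\<one>\<^bsub>poly_ring E\<^esub>}) \<and>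
      (let F = (\<Otimes>\<^bsub>poly_ring E\<^esub>i\<in>{1..k}. f i) in
         finite_expansion_property (poly_quotient E F) (mult_X E F) (residue_class E F ` R))"
proof -
  interpret E: principal_domain E
    by fact
  let ?P = "poly_ring E"
  interpret P: cring ?P
    by (rule E.univ_poly_is_cring[OF E.carrier_is_subring])
  have X: "X\<^bsub>E\<^esub> \<in> carrier ?P"
    by (rule E.var_closed(1)[OF E.carrier_is_subring])
  have R: "R \<subseteq> carrier ?P" and f: "\<And>i. i \<in> {1..k} \<Longrightarrow> f i \<in> carrier ?P"
    using assms(3) unfolding simultaneous_digit_system_def by auto
  obtain n where k: "k = Suc n"
    using assms(2) by (cases k) auto
  define F where "F = (\<Otimes>\<^bsub>?P\<^esub>i\<in>{1..k}. f i)"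
  \<comment> \<open>The canonical projection counts ideals from 0 to \<open>n\<close>, whereas
    \<open>f\<close> is indexed from 1 to \<open>k\<close>; hence the shift by
    \<open>Suc\<close>.\<close>
  define I where "I i = PIdl\<^bsub>?P\<^esub> (f (Suc i))" for i
  define h where "h = P.canonical_proj_ext I n"
  define S where "S = {\<Oplus>\<^bsub>?P\<^esub>i\<in>{..l::nat}. X\<^bsub>E\<^esub> [^]\<^bsub>?P\<^esub> i \<otimes>\<^bsub>?P\<^esub> c i | l c. \<forall>i\<le>l. c i \<in> R}"
  let ?V = "simultaneous_space E k f"
  have fS: "f (Suc i) \<in> carrier ?P" if "i \<le> n" for i
    using that f by (simp add: k)
  have ideals: "ideal (I i) ?P" if "i \<le> n" for i
    unfolding I_def using fS[OF that] by (rule P.cgenideal_ideal)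
  have indices: "{1..k} = Suc ` {..n}"
    by (simp add: k atMost_atLeast0 image_Suc_atLeastAtMost)
  have F_Suc: "F = (\<Otimes>\<^bsub>?P\<^esub>i\<in>{..n}. f (Suc i))"
    unfolding F_def indices using fS P.finprod_reindex[of f Suc "{..n}"] by (auto simp: Pi_def)
  have F: "F \<in> carrier ?P"
    unfolding F_def using f by (intro P.finprod_closed) auto
  have S: "S \<subseteq> carrier ?P"
    unfolding S_def using R X by (auto intro!: P.finsum_closed simp: Pi_def subset_eq)

  have mult_X: "mult_X E g (residue_class E g p) = residue_class E g (X\<^bsub>E\<^esub> \<otimes>\<^bsub>?P\<^esub> p)"
    if "g \<in> carrier ?P" "p \<in> carrier ?P" for g p
    using ring_hom_mult[OF ideal.rcos_ring_hom[OF P.cgenideal_ideal[OF that(1)]] X that(2)]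
    by (simp add: mult_X_def residue_class_def poly_quotient_def)

  have space: "?V = RDirProd_list (map (\<lambda>i. ?P Quot (I i)) [0..<Suc n])"
    by (simp add: simultaneous_space_def poly_quotient_def I_def k map_Suc_upt[symmetric] o_def
        del: upt_Suc)
  have h: "h p = map (\<lambda>i. residue_class E (f i) p) [1..<Suc k]" for p
    by (simp add: h_def P.canonical_proj_ext_def I_def residue_class_def k map_Suc_upt[symmetric]
        o_def del: upt_Suc)
  have digits: "simultaneous_digits E k f R = h ` R"
    by (simp add: simultaneous_digits_def h cong: image_cong)
  interpret h: ring_hom_ring ?P ?V h
    unfolding space h_def using ideals by (rule P.canonical_proj_ext_ring_hom)
  have \<phi>: "simultaneous_map E k f (h p) = h (X\<^bsub>E\<^esub> \<otimes>\<^bsub>?P\<^esub> p)" if "p \<in> carrier ?P" for p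
    unfolding simultaneous_map_def h using f that
    by (auto simp: mult_X intro!: nth_equalityI simp del: upt_Suc)
  have fep_V: "finite_expansion_property ?V (simultaneous_map E k f)
      (simultaneous_digits E k f R) \<longleftrightarrow> carrier ?V \<subseteq> h ` S"
    unfolding digits S_def using X R \<phi> by (rule h.finite_expansion_property_hom_iff)

  interpret F: ring_hom_ring ?P "poly_quotient E F" "residue_class E F"
    using ideal.rcos_ring_hom_ring[OF P.cgenideal_ideal[OF F]]
    by (simp add: poly_quotient_def residue_class_def[abs_def])
  have fep_F: "finite_expansion_property (poly_quotient E F) (mult_X E F) (residue_class E F ` R)
      \<longleftrightarrow> carrier (poly_quotient E F) \<subseteq> residue_class E F ` S"
    unfolding S_def using X R mult_X[OF F] by (rule F.finite_expansion_property_hom_iff)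
  \<comment> \<open>Unlike \<open>h\<close>, whose surjectivity will come from comaximality, the
    projection modulo \<open>F\<close> is always onto.\<close>
  have carrier_F: "carrier (poly_quotient E F) = residue_class E F ` carrier ?P"
    by (auto simp: poly_quotient_def residue_class_def FactRing_def A_RCOSETS_def')

  have residue_eq: "residue_class E g p = residue_class E g q \<longleftrightarrow> p \<ominus>\<^bsub>?P\<^esub> q \<in> PIdl\<^bsub>?P\<^esub> g"
    if "g \<in> carrier ?P" "p \<in> carrier ?P" "q \<in> carrier ?P" for g p q
    using P.quotient_eq_iff_same_a_r_cos[OF P.cgenideal_ideal] that by (simp add: residue_class_def)

  define comax where
    "comax \<longleftrightarrow> (\<forall>i\<le>n. \<forall>j\<le>n. i \<noteq> j \<longrightarrow> I i <+>\<^bsub>?P\<^esub> I j = carrier ?P)"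
  have comax_iff: "comax \<longleftrightarrow> (\<forall>i\<in>{1..k}. \<forall>j\<in>{1..k}. i \<noteq> j \<longrightarrow>
      Idl\<^bsub>?P\<^esub> {f i, f j} = Idl\<^bsub>?P\<^esub> {\<one>\<^bsub>?P\<^esub>})"
    unfolding indices using fS by (auto simp: comax_def I_def P.genideal_pair_eq_one_iff)
  \<comment> \<open>Under comaximality the intersection of the \<open>I i\<close> is generated by
    \<open>F\<close>, so \<open>h\<close> and the projection modulo \<open>F\<close> have the same
    kernel.\<close>
  have h_eq_iff: "h p = h q \<longleftrightarrow> residue_class E F p = residue_class E F q"
    if comax "p \<in> carrier ?P" "q \<in> carrier ?P" for p q
  proof -
    have "PIdl\<^bsub>?P\<^esub> F = (\<Inter>i\<le>n. I i)"
      unfolding F_Suc I_def using that(1) fS unfolding comax_def I_def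
      by (intro P.cgenideal_finprod_eq_Inter) auto
    moreover have "h p = h q \<longleftrightarrow> (\<forall>i\<le>n. I i +>\<^bsub>?P\<^esub> p = I i +>\<^bsub>?P\<^esub> q)"
      by (auto simp: h_def P.canonical_proj_ext_def less_Suc_eq_le simp del: upt_Suc)
    moreover have "\<dots> \<longleftrightarrow> (\<forall>i\<le>n. p \<ominus>\<^bsub>?P\<^esub> q \<in> I i)"
      using P.quotient_eq_iff_same_a_r_cos[OF ideals] that by blast
    ultimately show ?thesis
      using residue_eq[OF F] that by auto
  qed

  have "carrier ?V \<subseteq> h ` S \<longleftrightarrow> comax \<and> carrier (poly_quotient E F) \<subseteq> residue_class E F ` S"
  proof (cases comax)
    case True
    then have surj: "h ` carrier ?P = carrier ?V"
      unfolding h_def space comax_def by (intro P.canonical_proj_ext_is_surj ideals) auto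
    \<comment> \<open>Both coverings say that each polynomial has the same image as some member of
      \<open>S\<close>; \<open>h_eq_iff\<close> exchanges the two maps in that statement.\<close>
    have "carrier ?V \<subseteq> h ` S \<longleftrightarrow> (\<forall>p\<in>carrier ?P. \<exists>s\<in>S. h p = h s)"
      unfolding surj[symmetric] by (auto simp: image_iff subset_eq)
    also have "\<dots> \<longleftrightarrow> (\<forall>p\<in>carrier ?P. \<exists>s\<in>S. residue_class E F p = residue_class E F s)"
      using S by (intro ball_cong bex_cong refl h_eq_iff[OF True]) auto
    also have "\<dots> \<longleftrightarrow> carrier (poly_quotient E F) \<subseteq> residue_class E F ` S"
      unfolding carrier_F by (auto simp: image_iff subset_eq)
    finally show ?thesis
      using True by simp
  next
    case False
    \<comment> \<open>The right-hand side fails without comaximality. So does the left, since a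
      covering by \<open>S\<close> would make \<open>h\<close> onto.\<close>
    moreover have comax if "carrier ?V \<subseteq> h ` S"
      unfolding comax_def
    proof (intro allI impI)
      have "carrier ?V \<subseteq> h ` carrier ?P"
        using that S by blast
      then show "I i <+>\<^bsub>?P\<^esub> I j = carrier ?P" if "i \<le> n" "j \<le> n" "i \<noteq> j" for i j
        unfolding h_def space
        using that by (intro P.canonical_proj_ext_surj_imp_comaximal[of n I] ideals)
    qed
    ultimately show ?thesis
      by blast
  qed
  then show ?thesis
    unfolding fep_V Let_def F_def[symmetric] fep_F comax_iff by blast
qed

end
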